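(* Let $R$ be a $\mathbf{k}$-module with two associative ($\mathbf{k}$-bilinear) multiplications $\ast,\odot$ and a $\mathbf{k}$-linear map $P:R\to R$ such that $$P(x)\ast P(y)=P\big(x\ast P(y)+P(x)\ast y+x\odot y\big),\quad \forall x,y\in R.$$ Define $$x\prec_P y:=x\ast P(y),\quad x\succ_P y:=P(x)\ast y,\quad x\cdot_P y:=x\odot y,\quad \forall x,y\in R.$$ Then $(R,\prec_P,\succ_P,\cdot_P)$ is a tridendriform algebra if and only if $(R,\ast,\odot,P)$ is a restricted Rota-Baxter totally compatible dialgebra.
   Context: $\mathbf{k}$ is a commutative unitary ring. A tridendriform algebra is a quadruple $(T,\prec,\succ,\cdot)$ consisting of a $\mathbf{k}$-module $T$ and three bilinear products such that, for all $x,y,z\in T$, with $\star=\prec+\succ+\cdot$ (that is, $x\star y=x\prec y+x\succ y+x\cdot y$): $(x\prec y)\prec z=x\prec(y\star z)$, $(x\succ y)\prec z=x\succ(y\prec z)$, $(x\star y)\succ z=x\succ(y\succ z)$, $(x\succ y)\cdot z=x\succ(y\cdot z)$, $(x\prec y)\cdot z=x\cdot(y\succ z)$, $(x\cdot y)\prec z=x\cdot(y\prec z)$, $(x\cdot y)\cdot z=x\cdot(y\cdot z)$. A restricted Rota-Baxter totally compatible dialgebra is a quadruple $(R,\ast,\odot,P)$ where $R$ is a $\mathbf{k}$-module, $\ast,\odot$ are associative (bilinear) multiplications on $R$, and $P:R\to R$ is a linear operator, such that for all $x,y,z\in R$: $(P(x)\ast y)\odot z=P(x)\ast(y\odot z)$,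 $(x\ast P(y))\odot z=x\odot(P(y)\ast z)$, $(x\odot y)\ast P(z)=x\odot(y\ast P(z))$, and $P(x)\ast P(y)=P(x\ast P(y))+P(P(x)\ast y)+P(x\odot y)$. *)

theory Defs
  imports "HOL-Algebra.Module"
begin

text \<open>
  The base ring is an arbitrary commutative unital ring in the sense of HOL-Algebra (the zero ring
  is not excluded), and modules are the carrier-based ones of the locale \<open>module\<close>. That locale is
  stated over records that also have ring multiplication fields; nothing is assumed about those
  fields, and the products below are separate parameters. All identities range over the carrier.
\<close>

definition linear_map ::
  "('a, 'k) ring_scheme \<Rightarrow> ('a, 'b, 'm) module_scheme \<Rightarrow> ('a, 'c, 'n) module_scheme
    \<Rightarrow> ('b \<Rightarrow> 'c) \<Rightarrow> bool"
  where "linear_map k M N f \<longleftrightarrow>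
    f \<in> hom (add_monoid M) (add_monoid N) \<and>
    (\<forall>a\<in>carrier k. \<forall>x\<in>carrier M. f (a \<odot>\<^bsub>M\<^esub> x) = a \<odot>\<^bsub>N\<^esub> f x)"

definition bilinear_product ::
  "('a, 'k) ring_scheme \<Rightarrow> ('a, 'b, 'm) module_scheme \<Rightarrow> ('b \<Rightarrow> 'b \<Rightarrow> 'b) \<Rightarrow> bool"
  where "bilinear_product k M f \<longleftrightarrow>
    (\<forall>x\<in>carrier M. linear_map k M M (\<lambda>y. f x y)) \<and>
    (\<forall>y\<in>carrier M. linear_map k M M (\<lambda>x. f x y))"

definition associative_on :: "'b set \<Rightarrow> ('b \<Rightarrow> 'b \<Rightarrow> 'b) \<Rightarrow> bool"
  where "associative_on A f \<longleftrightarrow>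
    (\<forall>x\<in>A. \<forall>y\<in>A. \<forall>z\<in>A. f (f x y) z = f x (f y z))"

locale tridendriform_algebra = module k T
  for k (structure) and T (structure) +
  fixes prec :: "'c \<Rightarrow> 'c \<Rightarrow> 'c" (infixl "\<prec>" 70)
    and succ :: "'c \<Rightarrow> 'c \<Rightarrow> 'c" (infixl "\<succ>" 70)
    and dot :: "'c \<Rightarrow> 'c \<Rightarrow> 'c" (infixl "\<cdot>" 70)
    and star :: "'c \<Rightarrow> 'c \<Rightarrow> 'c" (infixl "\<star>" 70)
  defines "x \<star> y \<equiv> x \<prec> y \<oplus>\<^bsub>T\<^esub> x \<succ> y \<oplus>\<^bsub>T\<^esub> x \<cdot> y"
  assumes prec_bilinear: "bilinear_product k T (\<prec>)"
    and succ_bilinear: "bilinear_product k T (\<succ>)"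
    and dot_bilinear: "bilinear_product k T (\<cdot>)"
    and prec_prec: "\<lbrakk>x \<in> carrier T; y \<in> carrier T; z \<in> carrier T\<rbrakk>
      \<Longrightarrow> (x \<prec> y) \<prec> z = x \<prec> (y \<star> z)"
    and succ_prec: "\<lbrakk>x \<in> carrier T; y \<in> carrier T; z \<in> carrier T\<rbrakk>
      \<Longrightarrow> (x \<succ> y) \<prec> z = x \<succ> (y \<prec> z)"
    and star_succ: "\<lbrakk>x \<in> carrier T; y \<in> carrier T; z \<in> carrier T\<rbrakk>
      \<Longrightarrow> (x \<star> y) \<succ> z = x \<succ> (y \<succ> z)"
    and succ_dot: "\<lbrakk>x \<in> carrier T; y \<in> carrier T; z \<in> carrier T\<rbrakk>
      \<Longrightarrow> (x \<succ> y) \<cdot> z = x \<succ> (y \<cdot> z)"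
    and prec_dot: "\<lbrakk>x \<in> carrier T; y \<in> carrier T; z \<in> carrier T\<rbrakk>
      \<Longrightarrow> (x \<prec> y) \<cdot> z = x \<cdot> (y \<succ> z)"
    and dot_prec: "\<lbrakk>x \<in> carrier T; y \<in> carrier T; z \<in> carrier T\<rbrakk>
      \<Longrightarrow> (x \<cdot> y) \<prec> z = x \<cdot> (y \<prec> z)"
    and dot_dot: "\<lbrakk>x \<in> carrier T; y \<in> carrier T; z \<in> carrier T\<rbrakk>
      \<Longrightarrow> (x \<cdot> y) \<cdot> z = x \<cdot> (y \<cdot> z)"

text \<open>The symbol \<open>\<circledcirc>\<close> stands for the second product, usually written as a circled dot,
  because HOL-Algebra uses the latter for scalar multiplication.\<close>

locale restricted_RB_totally_compatible_dialgebra = module k R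
  for k (structure) and R (structure) +
  fixes ast :: "'c \<Rightarrow> 'c \<Rightarrow> 'c" (infixl "\<ast>" 70)
    and odot :: "'c \<Rightarrow> 'c \<Rightarrow> 'c" (infixl "\<circledcirc>" 70)
    and P :: "'c \<Rightarrow> 'c"
  assumes ast_bilinear: "bilinear_product k R (\<ast>)"
    and ast_assoc: "associative_on (carrier R) (\<ast>)"
    and odot_bilinear: "bilinear_product k R (\<circledcirc>)"
    and odot_assoc: "associative_on (carrier R) (\<circledcirc>)"
    and P_linear: "linear_map k R R P"
    and P_ast_odot: "\<lbrakk>x \<in> carrier R; y \<in> carrier R; z \<in> carrier R\<rbrakk>
      \<Longrightarrow> (P x \<ast> y) \<circledcirc> z = P x \<ast> (y \<circledcirc> z)"
    and ast_P_odot: "\<lbrakk>x \<in> carrier R; y \<in> carrier R; z \<in> carrier R\<rbrakk>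
      \<Longrightarrow> (x \<ast> P y) \<circledcirc> z = x \<circledcirc> (P y \<ast> z)"
    and odot_ast_P: "\<lbrakk>x \<in> carrier R; y \<in> carrier R; z \<in> carrier R\<rbrakk>
      \<Longrightarrow> (x \<circledcirc> y) \<ast> P z = x \<circledcirc> (y \<ast> P z)"
    and rota_baxter: "\<lbrakk>x \<in> carrier R; y \<in> carrier R\<rbrakk>
      \<Longrightarrow> P x \<ast> P y = P (x \<ast> P y) \<oplus>\<^bsub>R\<^esub> P (P x \<ast> y) \<oplus>\<^bsub>R\<^esub> P (x \<circledcirc> y)"

end

theory Submission
  imports Defs
begin

text \<open>
  Bilinearity of \<open>\<prec>\<^sub>P\<close> and \<open>\<succ>\<^sub>P\<close> is inherited from \<open>\<ast>\<close> and \<open>P\<close>. The Rota-Baxter identity says that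
  \<open>P\<close> sends the sum \<open>x \<star> y\<close> of the three new products to \<open>P x \<ast> P y\<close>. The three tridendriform
  identities in which \<open>\<cdot>\<^sub>P\<close> occurs at most inside \<open>\<star>\<close> therefore reduce to associativity of \<open>\<ast>\<close>, for
  instance \<open>(x \<ast> P y) \<ast> P z = x \<ast> (P y \<ast> P z) = x \<ast> P (y \<star> z)\<close>, and the identity with \<open>\<cdot>\<^sub>P\<close> alone is
  associativity of \<open>\<circledcirc>\<close>. The remaining three identities mix \<open>\<cdot>\<^sub>P\<close> with \<open>\<prec>\<^sub>P\<close> or \<open>\<succ>\<^sub>P\<close>; written out in
  \<open>\<ast>\<close>, \<open>\<circledcirc>\<close> and \<open>P\<close>, they are literally the three compatibility conditions of a restricted
  Rota-Baxter totally compatible dialgebra. The other conditions on such a dialgebra are among the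
  hypotheses, once additivity of \<open>P\<close> has split the Rota-Baxter identity into three summands. So each
  side of the equivalence amounts to the three compatibility conditions.
\<close>

lemma linear_map_closed:
  "linear_map k M N f \<Longrightarrow> x \<in> carrier M \<Longrightarrow> f x \<in> carrier N"
  by (auto simp: linear_map_def hom_def)

lemma linear_map_add:
  "linear_map k M N f \<Longrightarrow> x \<in> carrier M \<Longrightarrow> y \<in> carrier M \<Longrightarrow>
    f (x \<oplus>\<^bsub>M\<^esub> y) = f x \<oplus>\<^bsub>N\<^esub> f y"
  by (auto simp: linear_map_def hom_def)

lemma linear_map_compose:
  assumes "linear_map k L M f" and "linear_map k M N g"
  shows "linear_map k L N (\<lambda>x. g (f x))"
  using assms by (auto simp: linear_map_def hom_def Pi_def)

lemma bilinear_product_closed: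
  "bilinear_product k M f \<Longrightarrow> x \<in> carrier M \<Longrightarrow> y \<in> carrier M \<Longrightarrow> f x y \<in> carrier M"
  by (auto simp: bilinear_product_def dest: linear_map_closed)

lemma bilinear_product_compose_right:
  assumes "bilinear_product k M f" and "linear_map k M M P"
  shows "bilinear_product k M (\<lambda>x y. f x (P y))"
  using assms unfolding bilinear_product_def
  by (blast intro: linear_map_compose linear_map_closed)

lemma bilinear_product_compose_left:
  assumes "bilinear_product k M f" and "linear_map k M M P"
  shows "bilinear_product k M (\<lambda>x y. f (P x) y)"
  using assms unfolding bilinear_product_def
  by (blast intro: linear_map_compose[of k M M P M "\<lambda>x. f x y" for y] linear_map_closed)

theorem theorem3p6:
  fixes k :: "('a, 'k) ring_scheme"
    and R :: "('a, 'b, 'm) module_scheme"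
    and ast :: "'b \<Rightarrow> 'b \<Rightarrow> 'b" (infixl "\<ast>" 70)
    and odot :: "'b \<Rightarrow> 'b \<Rightarrow> 'b" (infixl "\<circledcirc>" 70)
    and P :: "'b \<Rightarrow> 'b"
  assumes "module k R"
    and "bilinear_product k R (\<ast>)" and "associative_on (carrier R) (\<ast>)"
    and "bilinear_product k R (\<circledcirc>)" and "associative_on (carrier R) (\<circledcirc>)"
    and "linear_map k R R P"
    and "\<And>x y. x \<in> carrier R \<Longrightarrow> y \<in> carrier R \<Longrightarrow>
      P x \<ast> P y = P (x \<ast> P y \<oplus>\<^bsub>R\<^esub> P x \<ast> y \<oplus>\<^bsub>R\<^esub> x \<circledcirc> y)"
  shows "tridendriform_algebra k R (\<lambda>x y. x \<ast> P y) (\<lambda>x y. P x \<ast> y) (\<lambda>x y. x \<circledcirc> y)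
    \<longleftrightarrow> restricted_RB_totally_compatible_dialgebra k R (\<ast>) (\<circledcirc>) P"
proof -
  interpret module k R by fact
  note P_closed = linear_map_closed[OF assms(6)]
  note ast_closed = bilinear_product_closed[OF assms(2)]
  note odot_closed = bilinear_product_closed[OF assms(4)]
  have ast_assoc: "(x \<ast> y) \<ast> z = x \<ast> (y \<ast> z)"
    if "x \<in> carrier R" "y \<in> carrier R" "z \<in> carrier R" for x y z
    using assms(3) that by (simp add: associative_on_def)
  have odot_assoc: "(x \<circledcirc> y) \<circledcirc> z = x \<circledcirc> (y \<circledcirc> z)"
    if "x \<in> carrier R" "y \<in> carrier R" "z \<in> carrier R" for x y z
    using assms(5) that by (simp add: associative_on_def)
  show ?thesis
  proof
    assume "tridendriform_algebra k R (\<lambda>x y. x \<ast> P y) (\<lambda>x y. P x \<ast> y) (\<lambda>x y. x \<circledcirc> y)"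
    then interpret T: tridendriform_algebra k R
      "\<lambda>x y. x \<ast> P y" "\<lambda>x y. P x \<ast> y" "\<lambda>x y. x \<circledcirc> y"
      "\<lambda>x y. x \<ast> P y \<oplus>\<^bsub>R\<^esub> P x \<ast> y \<oplus>\<^bsub>R\<^esub> x \<circledcirc> y" .
    show "restricted_RB_totally_compatible_dialgebra k R (\<ast>) (\<circledcirc>) P"
    proof
      show "P x \<ast> P y = P (x \<ast> P y) \<oplus>\<^bsub>R\<^esub> P (P x \<ast> y) \<oplus>\<^bsub>R\<^esub> P (x \<circledcirc> y)"
        if "x \<in> carrier R" "y \<in> carrier R" for x y
        using that by (simp add: assms(7) linear_map_add[OF assms(6)]
            P_closed ast_closed odot_closed)
    qed (fact assms T.succ_dot T.prec_dot T.dot_prec)+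
  next
    assume "restricted_RB_totally_compatible_dialgebra k R (\<ast>) (\<circledcirc>) P"
    then interpret D: restricted_RB_totally_compatible_dialgebra k R "(\<ast>)" "(\<circledcirc>)" P .
    show "tridendriform_algebra k R (\<lambda>x y. x \<ast> P y) (\<lambda>x y. P x \<ast> y) (\<lambda>x y. x \<circledcirc> y)"
    proof
      show "bilinear_product k R (\<lambda>x y. x \<ast> P y)"
        using assms(2,6) by (rule bilinear_product_compose_right)
      show "bilinear_product k R (\<lambda>x y. P x \<ast> y)"
        using assms(2,6) by (rule bilinear_product_compose_left)
      fix x y z
      assume carr: "x \<in> carrier R" "y \<in> carrier R" "z \<in> carrier R"
      show "(x \<ast> P y) \<ast> P z = x \<ast> P (y \<ast> P z \<oplus>\<^bsub>R\<^esub> P y \<ast> z \<oplus>\<^bsub>R\<^esub> y \<circledcirc> z)"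
        using carr by (simp add: ast_assoc P_closed assms(7)[symmetric])
      show "(P x \<ast> y) \<ast> P z = P x \<ast> (y \<ast> P z)"
        using carr by (simp add: ast_assoc P_closed)
      show "P (x \<ast> P y \<oplus>\<^bsub>R\<^esub> P x \<ast> y \<oplus>\<^bsub>R\<^esub> x \<circledcirc> y) \<ast> z = P x \<ast> (P y \<ast> z)"
        using carr by (simp add: ast_assoc P_closed assms(7)[symmetric])
    qed (fact assms odot_assoc D.P_ast_odot D.ast_P_odot D.odot_ast_P)+
  qed
qed

end
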